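(* Consider the grand partition function $$\Xi_\ell(z):=\sum_{\sigma\in\Sigma:\,\sigma=S^\ell\sigma}z^{\sum_{j=0}^{\ell-1}\sigma_j}\prod_{k=0}^{\ell-1}\psi(S^k\sigma)$$ and the two-variable zeta function $$\zeta_2(w,z)=\exp\sum_{\ell=1}^\infty\frac{w^\ell}{\ell}\,\Xi_\ell(z).$$ Then $$\zeta_2(1,z)=(1-z)\,\zeta(\varphi,z)\qquad\text{and}\qquad\zeta_2(w,1)=\zeta(\psi,w)$$ wherever the series expansions converge absolutely.
   Context: Shift and potential. $\Omega=\{0,1\}^{\{0,1,2,\dots\}}$, $T$ is the left shift, $0^\infty=(000\dots)$, $\tau(\omega)=1+\inf\{i\ge 0:\omega_i=1\}$ (with $\inf\emptyset=\infty$), $A_k=\{\omega:\tau(\omega)=k\}$ for $k\ge1$. Let $\Omega_*$ be the set of $\omega\in\Omega$ with infinitely many $1$'s. For $\omega\in\Omega_*$ the times between passages are $\sigma_k(\omega)=\tau\big((T^\tau)^k\omega\big)$, $k\ge 0$, where $T^\tau\omega=T^{\tau(\omega)}\omega$. A potential $V:\Omega\to\mathbb R$ is given, with induced version $W(\omega)=\sum_{k=0}^{\tau(\omega)-1}V(T^k\omega)$, satisfying: (1) $V$ is continuous, $-C_1\le V\le 0$ for some constant $C_1>0$, and $V(0^\infty)=0$; (2) $\sum_{n\ge1}\exp(\sup_{A_n}W)<C_2$ for some constant $C_2$; (3) for some $0<\theta<1$ and $C_3>0$, for all $n\ge1$, $\mathrm{Var}_nW\le C_3\theta^n$, where $\mathrm{Var}_nW=\sup\{|W(\omega)-W(\omega')|:\inf\{k\ge0:\sigma_k(\omega)\ne\sigma_k(\omega')\}=n\}$;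 (4) the limit $\lim_n\frac1n\log\sum_{\omega_0,\dots,\omega_{n-1}}\exp\big(\sup_{\omega'\in\Omega}\sum_{i=0}^{n-1}V(\omega_i\dots\omega_{n-1}\omega')\big)$ exists and equals $0$. Induced system. $\Sigma=\{1,2,3,\dots\}^{\{0,1,2,\dots\}}$ with left shift $S$; $\iota(\omega)=(\sigma_0(\omega)\sigma_1(\omega)\dots)$ is a bijection $\Omega_*\to\Sigma$ conjugating $T^\tau$ to $S$. $W$ is also viewed as a function on $\Sigma$ through $\iota$. $\varphi=\exp V$ on $\Omega$ and $\psi=\exp W$ on $\Sigma$. Zeta functions. $\zeta(\varphi,z)=\exp\sum_{n\ge1}\frac{z^n}{n}Q_n$ with $Q_n=\sum_{\omega\in\Omega:\,T^n\omega=\omega}\prod_{k=0}^{n-1}\varphi(T^k\omega)$, and $\zeta(\psi,w)=\exp\sum_{n\ge1}\frac{w^n}{n}Z_n$ with $Z_n=\sum_{\sigma\in\Sigma:\,S^n\sigma=\sigma}\prod_{k=0}^{n-1}\psi(S^k\sigma)$. *)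

theory Defs
  imports "HOL-Analysis.Analysis"
begin

text \<open>
  A point of \<open>{0,1}\<close>-sequence space is a function \<open>nat \<Rightarrow> bool\<close> (\<open>True\<close> stands for the
  symbol 1), with the library's product topology on function types. The induced symbol space
  consists of the sequences of positive integers.
\<close>

definition shift :: "(nat \<Rightarrow> 'a) \<Rightarrow> nat \<Rightarrow> 'a" where
  "shift x = (\<lambda>i. x (Suc i))"

definition zero_seq :: "nat \<Rightarrow> bool" where
  "zero_seq = (\<lambda>_. False)"

text \<open>The infimum is taken in \<open>enat\<close>, so it is \<open>\<infinity>\<close> on the empty set.\<close>

definition tau :: "(nat \<Rightarrow> bool) \<Rightarrow> enat" where
  "tau x = 1 + (INF i\<in>{i. x i}. enat i)"

definition cyl :: "nat \<Rightarrow> (nat \<Rightarrow> bool) set" where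
  "cyl k = {x. tau x = enat k}"

definition Omega_star :: "(nat \<Rightarrow> bool) set" where
  "Omega_star = {x. infinite {i. x i}}"

text \<open>
  \<open>shift_tau\<close> and \<open>iota\<close> are only meaningful where the passage times are finite, in particular
  on \<open>Omega_star\<close>.
\<close>

definition shift_tau :: "(nat \<Rightarrow> bool) \<Rightarrow> nat \<Rightarrow> bool" where
  "shift_tau x = (shift ^^ the_enat (tau x)) x"

definition passage :: "nat \<Rightarrow> (nat \<Rightarrow> bool) \<Rightarrow> enat" where
  "passage k x = tau ((shift_tau ^^ k) x)"

definition Sigma_seq :: "(nat \<Rightarrow> nat) set" where
  "Sigma_seq = {s. \<forall>i. 1 \<le> s i}"

definition iota :: "(nat \<Rightarrow> bool) \<Rightarrow> nat \<Rightarrow> nat" where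
  "iota x = (\<lambda>k. the_enat (passage k x))"

text \<open>
  At \<open>zero_seq\<close> the index set is infinite and the library sum is \<open>0\<close>; this is the value of the
  series when the potential vanishes at \<open>zero_seq\<close>.
\<close>

definition induced :: "((nat \<Rightarrow> bool) \<Rightarrow> real) \<Rightarrow> (nat \<Rightarrow> bool) \<Rightarrow> real" where
  "induced V x = (\<Sum>k | enat k < tau x. V ((shift ^^ k) x))"

definition induced_var :: "((nat \<Rightarrow> bool) \<Rightarrow> real) \<Rightarrow> nat \<Rightarrow> ereal" where
  "induced_var V n =
     (SUP (x, y) \<in> {(x, y). x \<in> Omega_star \<and> y \<in> Omega_star \<and>
                       (INF k\<in>{k. passage k x \<noteq> passage k y}. enat k) = enat n}.
        ereal \<bar>induced V x - induced V y\<bar>)"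

definition prepend :: "bool list \<Rightarrow> (nat \<Rightarrow> bool) \<Rightarrow> nat \<Rightarrow> bool" where
  "prepend u x = (\<lambda>i. if i < length u then u ! i else x (i - length u))"

definition pressure_sum :: "((nat \<Rightarrow> bool) \<Rightarrow> real) \<Rightarrow> nat \<Rightarrow> real" where
  "pressure_sum V n =
     (\<Sum>u | length u = n. exp (SUP x. \<Sum>i<n. V (prepend (drop i u) x)))"

definition phi :: "((nat \<Rightarrow> bool) \<Rightarrow> real) \<Rightarrow> (nat \<Rightarrow> bool) \<Rightarrow> real" where
  "phi V x = exp (V x)"

definition psi :: "((nat \<Rightarrow> bool) \<Rightarrow> real) \<Rightarrow> (nat \<Rightarrow> nat) \<Rightarrow> real" where
  "psi V s = exp (induced V (inv_into Omega_star iota s))"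

definition fixpts :: "nat \<Rightarrow> (nat \<Rightarrow> 'a) set \<Rightarrow> (nat \<Rightarrow> 'a) set" where
  "fixpts n X = {x \<in> X. (shift ^^ n) x = x}"

definition orbit_weight :: "((nat \<Rightarrow> 'a) \<Rightarrow> real) \<Rightarrow> nat \<Rightarrow> (nat \<Rightarrow> 'a) \<Rightarrow> real" where
  "orbit_weight g n x = (\<Prod>k<n. g ((shift ^^ k) x))"

text \<open>
  Zeta function of a weight \<open>g\<close> for the shift on \<open>X\<close>; it is used both on \<open>UNIV\<close> with \<open>phi V\<close>,
  where the sum over periodic points is finite, and on \<open>Sigma_seq\<close> with \<open>psi V\<close>, where it is
  infinite.
\<close>

definition part_sum :: "(nat \<Rightarrow> 'a) set \<Rightarrow> ((nat \<Rightarrow> 'a) \<Rightarrow> real) \<Rightarrow> nat \<Rightarrow> real" where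
  "part_sum X g n = (\<Sum>\<^sub>\<infinity>x\<in>fixpts n X. orbit_weight g n x)"

definition zeta_term ::
    "(nat \<Rightarrow> 'a) set \<Rightarrow> ((nat \<Rightarrow> 'a) \<Rightarrow> real) \<Rightarrow> complex \<Rightarrow> nat \<Rightarrow> complex" where
  "zeta_term X g z n = z ^ n / of_nat n * of_real (part_sum X g n)"

definition zeta_abs_conv :: "(nat \<Rightarrow> 'a) set \<Rightarrow> ((nat \<Rightarrow> 'a) \<Rightarrow> real) \<Rightarrow> complex \<Rightarrow> bool" where
  "zeta_abs_conv X g z \<longleftrightarrow>
     (\<forall>n\<ge>1. (\<lambda>x. norm (orbit_weight g n x)) summable_on fixpts n X) \<and>
     (\<lambda>n. norm (zeta_term X g z n)) summable_on {1..}"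

definition zeta :: "(nat \<Rightarrow> 'a) set \<Rightarrow> ((nat \<Rightarrow> 'a) \<Rightarrow> real) \<Rightarrow> complex \<Rightarrow> complex" where
  "zeta X g z = exp (\<Sum>\<^sub>\<infinity>n\<in>{1..}. zeta_term X g z n)"

definition Xi_term ::
    "((nat \<Rightarrow> bool) \<Rightarrow> real) \<Rightarrow> nat \<Rightarrow> complex \<Rightarrow> (nat \<Rightarrow> nat) \<Rightarrow> complex" where
  "Xi_term V l z s = z ^ (\<Sum>j<l. s j) * of_real (orbit_weight (psi V) l s)"

definition Xi :: "((nat \<Rightarrow> bool) \<Rightarrow> real) \<Rightarrow> nat \<Rightarrow> complex \<Rightarrow> complex" where
  "Xi V l z = (\<Sum>\<^sub>\<infinity>s\<in>fixpts l Sigma_seq. Xi_term V l z s)"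

definition zeta2_term ::
    "((nat \<Rightarrow> bool) \<Rightarrow> real) \<Rightarrow> complex \<Rightarrow> complex \<Rightarrow> nat \<Rightarrow> complex" where
  "zeta2_term V w z l = w ^ l / of_nat l * Xi V l z"

text \<open>
  Absolute convergence of the iterated series. It is implied by absolute convergence of the
  double series over \<open>l\<close> and the periodic points, except that for \<open>w = 0\<close> it also asks that
  each \<open>Xi V l z\<close> converge.
\<close>

definition zeta2_abs_conv :: "((nat \<Rightarrow> bool) \<Rightarrow> real) \<Rightarrow> complex \<Rightarrow> complex \<Rightarrow> bool" where
  "zeta2_abs_conv V w z \<longleftrightarrow>
     (\<forall>l\<ge>1. (\<lambda>s. norm (Xi_term V l z s)) summable_on fixpts l Sigma_seq) \<and>
     (\<lambda>l. norm (zeta2_term V w z l)) summable_on {1..}"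

definition zeta2 :: "((nat \<Rightarrow> bool) \<Rightarrow> real) \<Rightarrow> complex \<Rightarrow> complex \<Rightarrow> complex" where
  "zeta2 V w z = exp (\<Sum>\<^sub>\<infinity>l\<in>{1..}. zeta2_term V w z l)"

end

theory Submission
  imports Defs
begin

text \<open>
  A point \<open>s\<close> of period \<open>l\<close> in the induced system, with \<open>s 0 + \<dots> + s (l - 1) = n\<close>, is the same as
  a binary sequence of period \<open>n\<close> that has \<open>l\<close> ones per period, one of them at place \<open>n - 1\<close>, and the
  orbit weights agree. Rotating the period shows that dividing the weight by the number of ones
  and summing over these sequences gives \<open>1 / n\<close> times the sum of the weights of all points of
  period \<open>n\<close> other than \<open>zero_seq\<close>, which has weight 1. Hence the exponent of \<open>zeta2 V 1 z\<close> is
  that of \<open>zeta UNIV (phi V) z\<close> minus \<open>\<Sum> z^n / n = - ln (1 - z)\<close>. Since all weights are positive, the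
  rearrangement is justified by absolute convergence of \<open>zeta UNIV (phi V) z\<close>, which also forces
  \<open>norm z < 1\<close>.
\<close>

section \<open>Shifts and the first passage time\<close>

lemma shift_funpow_apply: "(shift ^^ k) x i = x (i + k)"
  by (induction k arbitrary: i) (simp_all add: shift_def)

lemma shift_funpow_zero_seq: "(shift ^^ k) zero_seq = zero_seq"
  by (simp add: zero_seq_def fun_eq_iff shift_funpow_apply)

lemma tau_eqI:
  assumes "x m" and "\<And>i. i < m \<Longrightarrow> \<not> x i"
  shows "tau x = enat (Suc m)"
proof -
  have "(INF i\<in>{i. x i}. enat i) = enat m"
  proof (rule antisym)
    show "(INF i\<in>{i. x i}. enat i) \<le> enat m"
      using assms(1) by (intro INF_lower) simp
    show "enat m \<le> (INF i\<in>{i. x i}. enat i)"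
      using assms(2) by (intro INF_greatest) (metis enat_ord_simps(1) linorder_not_less mem_Collect_eq)
  qed
  then show ?thesis
    by (simp add: tau_def one_enat_def)
qed

lemma shift_funpow_Sigma_seq: "s \<in> Sigma_seq \<Longrightarrow> (shift ^^ l) s \<in> Sigma_seq"
  by (simp add: Sigma_seq_def shift_funpow_apply)

subsection \<open>Coding of binary sequences by passage times\<close>

text \<open>The candidate inverse of \<open>iota\<close>: passage times add up to the places of the
  ones. Since \<open>tau\<close> counts from 1, a partial sum \<open>Suc i\<close> means a one at
  place \<open>i\<close>.\<close>

definition kappa :: "(nat \<Rightarrow> nat) \<Rightarrow> nat \<Rightarrow> bool" where
  "kappa s i \<longleftrightarrow> (\<exists>k. Suc i = (\<Sum>j\<le>k. s j))"

text \<open>Peels off the first partial sum; the remaining ones are those of the shifted code, moved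
  by \<open>s 0\<close>.\<close>

lemma kappa_rec:
  assumes "s \<in> Sigma_seq"
  shows "kappa s i \<longleftrightarrow> Suc i = s 0 \<or> s 0 \<le> i \<and> kappa (shift s) (i - s 0)"
proof -
  have pos: "(\<Sum>j\<le>k. shift s j) \<ge> 1" for k
  proof -
    have "shift s 0 \<le> (\<Sum>j\<le>k. shift s j)"
      by (rule member_le_sum) auto
    moreover have "1 \<le> shift s 0"
      using assms by (simp add: Sigma_seq_def shift_def)
    ultimately show ?thesis by linarith
  qed
  have "kappa s i \<longleftrightarrow> Suc i = (\<Sum>j\<le>0. s j) \<or> (\<exists>k. Suc i = (\<Sum>j\<le>Suc k. s j))"
    unfolding kappa_def by (metis not0_implies_Suc)
  also have "\<dots> \<longleftrightarrow> Suc i = s 0 \<or> (\<exists>k. Suc i = s 0 + (\<Sum>j\<le>k. shift s j))"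
    unfolding sum.atMost_Suc_shift shift_def by simp
  also have "\<dots> \<longleftrightarrow> Suc i = s 0 \<or> (\<exists>k. s 0 \<le> i \<and> Suc (i - s 0) = (\<Sum>j\<le>k. shift s j))"
  proof -
    \<comment> \<open>The sum is at least 1, so \<open>s 0 \<le> i\<close> and the subtraction of
      naturals is exact.\<close>
    have "Suc i = s 0 + (\<Sum>j\<le>k. shift s j) \<longleftrightarrow> s 0 \<le> i \<and> Suc (i - s 0) = (\<Sum>j\<le>k. shift s j)" for k
      using pos[of k] by linarith
    then show ?thesis by simp
  qed
  finally show ?thesis
    by (simp add: kappa_def)
qed

lemma tau_kappa:
  assumes "s \<in> Sigma_seq"
  shows "tau (kappa s) = enat (s 0)"
proof -
  obtain m where m: "s 0 = Suc m"
    using assms by (auto simp: Sigma_seq_def) (metis Suc_le_D)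
  show ?thesis
    unfolding m by (rule tau_eqI) (simp_all add: kappa_rec[OF assms] m)
qed

lemma shift_funpow_kappa:
  assumes "s \<in> Sigma_seq"
  shows "(shift ^^ s 0) (kappa s) = kappa (shift s)"
  using kappa_rec[OF assms] assms
  by (auto simp: shift_funpow_apply fun_eq_iff Sigma_seq_def)

lemma shift_tau_funpow_kappa:
  assumes "s \<in> Sigma_seq"
  shows "(shift_tau ^^ k) (kappa s) = kappa ((shift ^^ k) s)"
proof (induction k)
  case (Suc k)
  then show ?case
    using shift_funpow_Sigma_seq[OF assms, of k]
    by (simp add: shift_tau_def tau_kappa shift_funpow_kappa)
qed simp

lemma iota_kappa: "s \<in> Sigma_seq \<Longrightarrow> iota (kappa s) = s"
  by (simp add: iota_def passage_def shift_tau_funpow_kappa tau_kappa shift_funpow_Sigma_seq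
      shift_funpow_apply)

lemma kappa_Omega_star:
  assumes "s \<in> Sigma_seq"
  shows "kappa s \<in> Omega_star"
proof -
  have "\<exists>n>m. kappa s n" for m
  proof -
    \<comment> \<open>The entries are at least 1, so the partial sum of \<open>m + 2\<close> of them
      marks a one beyond place \<open>m\<close>.\<close>
    have "(\<Sum>j\<le>Suc m. 1) \<le> (\<Sum>j\<le>Suc m. s j)"
      using assms by (intro sum_mono) (simp add: Sigma_seq_def)
    then have "Suc (Suc m) \<le> (\<Sum>j\<le>Suc m. s j)" by simp
    then obtain n where "(\<Sum>j\<le>Suc m. s j) = Suc n" "n > m"
      by (metis Suc_le_D Suc_le_mono less_eq_Suc_le)
    then show ?thesis
      unfolding kappa_def by metis
  qed
  then show ?thesis
    by (simp add: Omega_star_def infinite_nat_iff_unbounded)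
qed

lemma tau_Omega_star:
  assumes "x \<in> Omega_star"
  obtains m where "x m" "\<And>i. i < m \<Longrightarrow> \<not> x i" "tau x = enat (Suc m)"
proof -
  obtain i where "x i"
    using assms by (auto simp: Omega_star_def dest: infinite_imp_nonempty)
  then have "x (LEAST i. x i)"
    by (rule LeastI)
  then show ?thesis
    using that tau_eqI[of x "LEAST i. x i"] not_less_Least by blast
qed

lemma shift_funpow_Omega_star:
  assumes "x \<in> Omega_star"
  shows "(shift ^^ k) x \<in> Omega_star"
proof -
  have "\<exists>n>m. x (n + k)" for m
  proof -
    obtain n where "n > m + k" "x n"
      using assms by (auto simp: Omega_star_def infinite_nat_iff_unbounded)
    then show ?thesis
      by (intro exI[of _ "n - k"]) auto
  qed
  then show ?thesis
    by (simp add: Omega_star_def infinite_nat_iff_unbounded shift_funpow_apply)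
qed

lemma shift_tau_funpow_Omega_star:
  "x \<in> Omega_star \<Longrightarrow> (shift_tau ^^ k) x \<in> Omega_star"
  by (induction k) (simp_all add: shift_tau_def shift_funpow_Omega_star)

lemma iota_Sigma_seq:
  assumes "x \<in> Omega_star"
  shows "iota x \<in> Sigma_seq"
proof -
  have "1 \<le> iota x k" for k
    using tau_Omega_star[OF shift_tau_funpow_Omega_star[OF assms, of k]]
    by (metis One_nat_def Suc_le_mono iota_def le0 passage_def the_enat.simps)
  then show ?thesis
    by (simp add: Sigma_seq_def)
qed

lemma shift_iota: "shift (iota x) = iota (shift_tau x)"
  by (simp add: fun_eq_iff shift_def iota_def passage_def funpow_swap1)

text \<open>Strong induction on the place: up to the first one both sides are known, and beyond it
  the claim for \<open>shift_tau x\<close> applies at a smaller place.\<close>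

lemma kappa_iota:
  assumes "x \<in> Omega_star"
  shows "kappa (iota x) = x"
proof
  fix i
  show "kappa (iota x) i = x i"
    using assms
  proof (induction i arbitrary: x rule: less_induct)
    case (less i)
    obtain m where m: "x m" "\<And>j. j < m \<Longrightarrow> \<not> x j" "tau x = enat (Suc m)"
      using tau_Omega_star[OF less.prems] by metis
    have iota0: "iota x 0 = Suc m"
      by (simp add: iota_def passage_def m(3))
    have rec: "kappa (iota x) i \<longleftrightarrow> i = m \<or> Suc m \<le> i \<and> kappa (iota (shift_tau x)) (i - Suc m)"
      using kappa_rec[OF iota_Sigma_seq[OF less.prems], of i] by (simp add: iota0 shift_iota)
    show ?case
    proof (cases "Suc m \<le> i")
      case True
      have "kappa (iota (shift_tau x)) (i - Suc m) = shift_tau x (i - Suc m)"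
        using less.IH[of "i - Suc m" "shift_tau x"] True
          shift_tau_funpow_Omega_star[OF less.prems, of 1] by simp
      also have "\<dots> = x i"
        using True by (simp add: shift_tau_def m(3) shift_funpow_apply del: funpow.simps)
      finally show ?thesis
        using True rec by auto
    next
      case False
      then show ?thesis
        using rec m(1,2) by (cases "i = m") auto
    qed
  qed
qed

text \<open>Replaces the choice-based inverse in \<open>psi\<close> by an explicit sequence.\<close>

lemma inv_into_iota:
  assumes "s \<in> Sigma_seq"
  shows "inv_into Omega_star iota s = kappa s"
proof (rule inv_into_f_eq)
  show "inj_on iota Omega_star"
    by (metis inj_onI kappa_iota)
qed (simp_all add: assms iota_kappa kappa_Omega_star)

text \<open>Since \<open>l\<close> induced steps take the first \<open>l\<close> passage times
  together, period \<open>l\<close> of \<open>s\<close> becomes period \<open>\<Sum>j<l. s j\<close>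
  of \<open>kappa s\<close>.\<close>

lemma shift_sum_kappa:
  assumes "s \<in> Sigma_seq"
  shows "(shift ^^ (\<Sum>j<l. s j)) (kappa s) = kappa ((shift ^^ l) s)"
proof (induction l)
  case (Suc l)
  have "(shift ^^ (\<Sum>j<Suc l. s j)) (kappa s) = (shift ^^ s l) ((shift ^^ (\<Sum>j<l. s j)) (kappa s))"
    by (simp add: funpow_add add.commute)
  also have "\<dots> = (shift ^^ ((shift ^^ l) s 0)) (kappa ((shift ^^ l) s))"
    unfolding Suc.IH by (simp add: shift_funpow_apply)
  also have "\<dots> = kappa ((shift ^^ Suc l) s)"
    using shift_funpow_kappa[OF shift_funpow_Sigma_seq[OF assms]] by simp
  finally show ?case .
qed simp

subsection \<open>Orbit weights and numbers of ones\<close>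

lemma orbit_weight_add:
  "orbit_weight g (m + n) x = orbit_weight g m x * orbit_weight g n ((shift ^^ m) x)"
proof -
  have "(shift ^^ k) ((shift ^^ m) x) = (shift ^^ (m + k)) x" for k
    by (simp add: funpow_add add.commute)
  then show ?thesis
    unfolding orbit_weight_def by (induction n) (simp_all add: mult.assoc)
qed

text \<open>On a periodic orbit the shift trades the factor \<open>g x\<close> for
  \<open>g ((shift ^^ n) x)\<close>, the same number.\<close>

lemma orbit_weight_shift:
  assumes "(shift ^^ n) x = x"
  shows "orbit_weight g n (shift x) = orbit_weight g n x"
proof (cases n)
  case (Suc m)
  have "orbit_weight g n (shift x) = orbit_weight g m (shift x) * g ((shift ^^ n) x)"
    by (simp add: orbit_weight_def Suc funpow_swap1)
  also have "\<dots> = orbit_weight g n x"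
    unfolding assms using orbit_weight_add[of g 1 m x] by (simp add: orbit_weight_def Suc)
  finally show ?thesis .
qed (simp add: orbit_weight_def)

lemma orbit_weight_phi: "orbit_weight (phi V) n x = exp (\<Sum>k<n. V ((shift ^^ k) x))"
  by (simp add: orbit_weight_def phi_def exp_sum)

definition ones :: "nat \<Rightarrow> (nat \<Rightarrow> bool) \<Rightarrow> nat" where
  "ones n x = (\<Sum>k<n. of_bool (x k))"

lemma ones_add: "ones (m + n) x = ones m x + ones n ((shift ^^ m) x)"
  by (induction n) (simp_all add: ones_def shift_funpow_apply add.commute)

lemma ones_shift:
  assumes "(shift ^^ n) x = x"
  shows "ones n (shift x) = ones n x"
proof -
  \<comment> \<open>Split a window of length \<open>n + 1\<close> after \<open>n\<close> places and
    after one place; by periodicity both splittings contain \<open>ones 1 x\<close>.\<close>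
  have "ones (n + 1) x = ones (1 + n) x" by simp
  then show ?thesis
    unfolding ones_add assms by (simp add: assms)
qed

text \<open>The exponential of the induced potential is a product over the first block, whose length
  \<open>tau (kappa s) = s 0\<close> is finite.\<close>

lemma psi_eq_orbit_weight:
  assumes "s \<in> Sigma_seq"
  shows "psi V s = orbit_weight (phi V) (s 0) (kappa s)"
proof -
  have "{k. k < s 0} = {..<s 0}" by auto
  then show ?thesis
    by (simp add: psi_def inv_into_iota assms induced_def tau_kappa orbit_weight_phi)
qed

lemma orbit_weight_psi:
  assumes "s \<in> Sigma_seq"
  shows "orbit_weight (psi V) l s = orbit_weight (phi V) (\<Sum>j<l. s j) (kappa s)"
proof (induction l)
  case (Suc l)
  then show ?case
    using psi_eq_orbit_weight[OF shift_funpow_Sigma_seq[OF assms, of l], of V]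
    by (simp add: orbit_weight_add shift_sum_kappa assms shift_funpow_apply)
      (simp add: orbit_weight_def)
qed (simp add: orbit_weight_def)

lemma ones_kappa:
  assumes "s \<in> Sigma_seq"
  shows "ones (\<Sum>j<l. s j) (kappa s) = l"
proof (induction l)
  case (Suc l)
  \<comment> \<open>A block of the coding consists of zeros followed by a single one.\<close>
  have one: "ones (t 0) (kappa t) = 1" if t: "t \<in> Sigma_seq" for t
  proof -
    obtain m where "t 0 = Suc m"
      using t by (auto simp: Sigma_seq_def) (metis Suc_le_D)
    then show ?thesis
      by (simp add: ones_def kappa_rec[OF t])
  qed
  show ?case
    using one[OF shift_funpow_Sigma_seq[OF assms, of l]]
    by (simp add: ones_add shift_sum_kappa assms Suc.IH shift_funpow_apply)
qed (simp add: ones_def)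

lemma ones_pos: "k < n \<Longrightarrow> x k \<Longrightarrow> ones n x > 0"
  unfolding ones_def by (rule sum_pos2) auto

subsection \<open>Periodic points\<close>

lemma fixpts_mod:
  assumes "x \<in> fixpts n X"
  shows "x i = x (i mod n)"
proof -
  have per: "x (j + n) = x j" for j
    using assms shift_funpow_apply[of n x j] by (simp add: fixpts_def)
  have "x (j + k * n) = x j" for j k
  proof (induction k)
    case (Suc k)
    then show ?case
      using per[of "j + k * n"] by (simp add: algebra_simps)
  qed simp
  from this[of "i mod n" "i div n"] show ?thesis by simp
qed

lemma finite_fixpts_bool:
  fixes X :: "(nat \<Rightarrow> bool) set"
  assumes "n \<ge> 1"
  shows "finite (fixpts n X)"
proof (rule inj_on_finite)
  \<comment> \<open>A periodic sequence is determined by the places of its ones in one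
    period.\<close>
  show "inj_on (\<lambda>x. {i. i < n \<and> x i}) (fixpts n X)"
  proof (intro inj_onI ext)
    fix x y :: "nat \<Rightarrow> bool" and i
    assume "x \<in> fixpts n X" "y \<in> fixpts n X" "{i. i < n \<and> x i} = {i. i < n \<and> y i}"
    moreover have "i mod n < n" using assms by simp
    ultimately show "x i = y i"
      using fixpts_mod by blast
  qed
  show "(\<lambda>x. {i. i < n \<and> x i}) ` fixpts n X \<subseteq> Pow {..<n}"
    by auto
qed simp

lemma shift_fixpts:
  "x \<in> fixpts n UNIV \<Longrightarrow> shift x \<in> fixpts n UNIV"
  by (simp add: fixpts_def flip: funpow_swap1)

text \<open>On points of period \<open>n\<close>, one shift is inverted by \<open>n - 1\<close>
  further shifts. The predicate \<open>P\<close> serves to match points with a one at place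
  \<open>k + 1\<close> with points with a one at place \<open>k\<close>.\<close>

lemma bij_betw_shift_fixpts:
  assumes "n \<ge> 1"
  shows "bij_betw shift {x \<in> fixpts n UNIV. P (shift x)} {x \<in> fixpts n UNIV. P x}"
proof (rule bij_betwI)
  have n: "Suc (n - 1) = n" using assms by simp
  show "(shift ^^ (n - 1)) \<in> {x \<in> fixpts n UNIV. P x} \<rightarrow> {x \<in> fixpts n UNIV. P (shift x)}"
  proof
    fix x assume x: "x \<in> {x \<in> fixpts n UNIV. P x}"
    have "(shift ^^ k) x \<in> fixpts n UNIV" for k
      using x by (induction k) (auto intro: shift_fixpts)
    moreover have "shift ((shift ^^ (n - 1)) x) = x"
      using x n by (metis (mono_tags) comp_apply fixpts_def funpow.simps(2) mem_Collect_eq)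
    ultimately show "(shift ^^ (n - 1)) x \<in> {x \<in> fixpts n UNIV. P (shift x)}"
      using x by simp
  qed
  show "shift \<in> {x \<in> fixpts n UNIV. P (shift x)} \<rightarrow> {x \<in> fixpts n UNIV. P x}"
    by (auto intro: shift_fixpts)
  show "(shift ^^ (n - 1)) (shift x) = x" if "x \<in> {x \<in> fixpts n UNIV. P (shift x)}" for x
    using that n by (metis (mono_tags) comp_apply fixpts_def funpow_Suc_right mem_Collect_eq)
  show "shift ((shift ^^ (n - 1)) x) = x" if "x \<in> {x \<in> fixpts n UNIV. P x}" for x
    using that n by (metis (mono_tags) comp_apply fixpts_def funpow.simps(2) mem_Collect_eq)
qed

text \<open>The binary side of the coding: as each block ends with its one, \<open>kappa\<close>
  sends induced periodic points to sequences whose period closes with a one.\<close>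

definition marked :: "nat \<Rightarrow> (nat \<Rightarrow> bool) set" where
  "marked n = {x \<in> fixpts n UNIV. x (n - 1)}"

text \<open>Count the pairs of a periodic point and a one in its period in two ways; a rotation moves
  the one to the last place.\<close>

lemma sum_marked:
  assumes "n \<ge> 1"
  shows "(\<Sum>x\<in>marked n. orbit_weight (phi V) n x / real (ones n x)) =
         (part_sum UNIV (phi V) n - orbit_weight (phi V) n zero_seq) / real n"
proof -
  define F where "F = (fixpts n UNIV :: (nat \<Rightarrow> bool) set)"
  define G where "G x = orbit_weight (phi V) n x / real (ones n x)" for x
  have fin: "finite F"
    unfolding F_def using assms by (rule finite_fixpts_bool)
  have G_shift: "G (shift x) = G x" if "x \<in> F" for x
    using that by (simp add: G_def F_def fixpts_def orbit_weight_shift ones_shift)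
  have step: "(\<Sum>x | x \<in> F \<and> x (Suc k). G x) = (\<Sum>x | x \<in> F \<and> x k. G x)" for k
  proof -
    have "(\<Sum>x | x \<in> F \<and> x k. G x) = (\<Sum>x | x \<in> F \<and> shift x k. G (shift x))"
      unfolding F_def
      by (rule sum.reindex_bij_betw[symmetric]) (rule bij_betw_shift_fixpts[OF assms])
    also have "\<dots> = (\<Sum>x | x \<in> F \<and> x (Suc k). G x)"
      by (intro sum.cong) (auto simp: G_shift, auto simp: shift_def)
    finally show ?thesis by simp
  qed
  have const: "(\<Sum>x | x \<in> F \<and> x k. G x) = (\<Sum>x | x \<in> F \<and> x 0. G x)" for k
    by (induction k) (simp_all add: step)
  have "(\<Sum>x | x \<in> F \<and> x k. G x) = (\<Sum>x\<in>marked n. G x)" for k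
    using const[of k] const[of "n - 1"] by (simp add: marked_def F_def)
  \<comment> \<open>The sums over points with a one at place \<open>k\<close> agree for all
    \<open>k < n\<close>, so together they make \<open>n\<close> copies of the marked sum.\<close>
  then have "real n * (\<Sum>x\<in>marked n. G x) = (\<Sum>k<n. \<Sum>x | x \<in> F \<and> x k. G x)"
    by simp
  also have "\<dots> = (\<Sum>k<n. \<Sum>x\<in>F. of_bool (x k) * G x)"
    by (simp only: sum.inter_filter[OF fin]) (auto intro!: sum.cong)
  also have "\<dots> = (\<Sum>x\<in>F. real (ones n x) * G x)"
    by (subst sum.swap) (simp add: ones_def sum_distrib_right)
  \<comment> \<open>The factor \<open>ones n x\<close> cancels the denominator of \<open>G\<close>,
    except at \<open>zero_seq\<close>, where it vanishes.\<close>
  also have "\<dots> = (\<Sum>x\<in>F - {zero_seq}. orbit_weight (phi V) n x)"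
  proof (rule sum.mono_neutral_cong_right)
    show "\<forall>x\<in>F - (F - {zero_seq}). real (ones n x) * G x = 0"
      by (auto simp: ones_def zero_seq_def)
    show "real (ones n x) * G x = orbit_weight (phi V) n x" if "x \<in> F - {zero_seq}" for x
    proof -
      from that obtain i where "x i"
        by (auto simp: zero_seq_def fun_eq_iff)
      then have "x (i mod n)"
        using that fixpts_mod[of x n UNIV i] by (simp add: F_def)
      then have "ones n x > 0"
        using assms by (intro ones_pos[of "i mod n"]) auto
      then show ?thesis by (simp add: G_def)
    qed
  qed (use fin in auto)
  also have "\<dots> = (\<Sum>x\<in>F. orbit_weight (phi V) n x) - orbit_weight (phi V) n zero_seq"
  proof -
    have "zero_seq \<in> F"
      by (simp add: F_def fixpts_def shift_funpow_zero_seq)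
    then show ?thesis
      using fin by (simp add: sum_diff1)
  qed
  also have "(\<Sum>x\<in>F. orbit_weight (phi V) n x) = part_sum UNIV (phi V) n"
    using fin by (simp add: part_sum_def F_def)
  finally show ?thesis
    using assms by (simp add: G_def field_simps)
qed

text \<open>The number of ones in a period recovers \<open>l\<close>, and \<open>iota\<close>
  recovers the code. The lengths are kept in the pairs because one sequence has many
  periods.\<close>

lemma bij_betw_marked:
  "bij_betw (\<lambda>(l, s). (\<Sum>j<l. s j, kappa s))
     (SIGMA l:{1..}. fixpts l Sigma_seq) (SIGMA n:{1..}. marked n)"
proof (rule bij_betwI[where g = "\<lambda>(n, x). (ones n x, iota x)"])
  show "(\<lambda>(l, s). (\<Sum>j<l. s j, kappa s)) \<in>
      (SIGMA l:{1..}. fixpts l Sigma_seq) \<rightarrow> (SIGMA n:{1..}. marked n)"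
  proof clarsimp
    fix l :: nat and s
    assume l: "Suc 0 \<le> l" and "s \<in> fixpts l Sigma_seq"
    then have s: "s \<in> Sigma_seq" "(shift ^^ l) s = s"
      by (auto simp: fixpts_def)
    define n where "n = (\<Sum>j<l. s j)"
    obtain k where k: "l = Suc k"
      using l by (metis Suc_le_D)
    have n1: "n \<ge> 1"
      using s(1) by (auto simp: n_def k Sigma_seq_def intro: trans_le_add2)
    \<comment> \<open>The witness \<open>k = l - 1\<close> is the index of the last summand of
      \<open>n\<close>: the last block ends at place \<open>n - 1\<close>.\<close>
    have "kappa s (n - 1)"
      unfolding kappa_def using n1
      by (intro exI[of _ k]) (simp add: n_def k lessThan_Suc_atMost del: sum.lessThan_Suc)
    moreover have "(shift ^^ n) (kappa s) = kappa s"
      unfolding n_def by (simp add: shift_sum_kappa s)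
    ultimately show "Suc 0 \<le> (\<Sum>j<l. s j) \<and> kappa s \<in> marked (\<Sum>j<l. s j)"
      using n1 by (simp add: marked_def fixpts_def flip: n_def)
  qed
  have inverse: "iota x \<in> Sigma_seq \<and> kappa (iota x) = x \<and> ones n x \<ge> 1 \<and>
      (shift ^^ ones n x) (iota x) = iota x \<and> (\<Sum>j<ones n x. iota x j) = n"
    if n: "n \<ge> 1" and x: "x \<in> marked n" for n x
  proof -
    have per: "(shift ^^ n) x = x" and last: "x (n - 1)"
      using x by (auto simp: marked_def fixpts_def)
    \<comment> \<open>The closing one recurs in every period, so \<open>x\<close> has infinitely
      many ones.\<close>
    have "x (n - 1 + k * n)" for k
    proof -
      have "(n - 1 + k * n) mod n = n - 1"
        using n by (subst mod_mult_self1) simp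
      then show ?thesis
        using x fixpts_mod[of x n UNIV "n - 1 + k * n"] last by (simp only: marked_def mem_Collect_eq)
    qed
    moreover have "m < n - 1 + Suc m * n" for m
    proof -
      have "Suc m * 1 \<le> Suc m * n"
        using n by (intro mult_le_mono2)
      then show ?thesis by simp
    qed
    ultimately have "\<exists>i>m. x i" for m by blast
    then have "x \<in> Omega_star"
      by (simp add: Omega_star_def infinite_nat_iff_unbounded)
    then have s: "iota x \<in> Sigma_seq" and kap: "kappa (iota x) = x"
      by (simp_all add: iota_Sigma_seq kappa_iota)
    \<comment> \<open>The one at place \<open>n - 1\<close> says that \<open>n\<close> is a partial
      sum of \<open>iota x\<close>; its number of terms, \<open>Suc k\<close>, is the number of ones
      in the period.\<close>
    from last n obtain k where "n = (\<Sum>j\<le>k. iota x j)"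
      by (metis One_nat_def Suc_pred kap kappa_def less_eq_Suc_le)
    then have l: "n = (\<Sum>j<Suc k. iota x j)"
      by (simp only: lessThan_Suc_atMost)
    then have ones: "ones n x = Suc k"
      using ones_kappa[OF s, of "Suc k"] kap by simp
    \<comment> \<open>Shifting \<open>x\<close> by \<open>n\<close> shifts its code by
      \<open>Suc k\<close>; applying \<open>iota\<close> then yields the period of the code.\<close>
    have "kappa ((shift ^^ Suc k) (iota x)) = x"
      using shift_sum_kappa[OF s, of "Suc k"] unfolding l[symmetric] by (simp only: kap per)
    then have "(shift ^^ Suc k) (iota x) = iota x"
      by (metis iota_kappa s shift_funpow_Sigma_seq)
    then show ?thesis
      using s kap l unfolding ones by simp
  qed
  show "(\<lambda>(n, x). (ones n x, iota x)) \<in>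
      (SIGMA n:{1..}. marked n) \<rightarrow> (SIGMA l:{1..}. fixpts l Sigma_seq)"
    using inverse by (fastforce simp: fixpts_def)
  show "(\<lambda>(n, x). (ones n x, iota x)) ((\<lambda>(l, s). (\<Sum>j<l. s j, kappa s)) p) = p"
    if "p \<in> (SIGMA l:{1..}. fixpts l Sigma_seq)" for p
    using that by (auto simp: fixpts_def ones_kappa iota_kappa)
  show "(\<lambda>(l, s). (\<Sum>j<l. s j, kappa s)) ((\<lambda>(n, x). (ones n x, iota x)) p) = p"
    if "p \<in> (SIGMA n:{1..}. marked n)" for p
    using that inverse by auto
qed

subsection \<open>Comparison of the zeta functions\<close>

lemma has_sum_power_div_nat:
  fixes z :: complex
  assumes "norm z < 1"
  shows "((\<lambda>n. z ^ n / of_nat n) has_sum - ln (1 - z)) {1..}"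
proof -
  have "(\<lambda>n. - (z ^ n / of_nat n)) sums ln (1 - z)"
    using Ln_series'[of "- z"] assms by simp
  then have sums: "(\<lambda>n. z ^ n / of_nat n) sums - ln (1 - z)"
    using sums_minus by fastforce
  have "summable (\<lambda>n. norm (z ^ n / of_nat n))"
  proof (rule summable_comparison_test)
    show "summable (\<lambda>n. norm z ^ n)"
      using assms by (simp add: summable_geometric)
    have "norm z ^ n / real n \<le> norm z ^ n / 1" if "n \<ge> 1" for n
      using that by (intro divide_left_mono) auto
    then show "\<exists>N. \<forall>n\<ge>N. norm (norm (z ^ n / of_nat n)) \<le> norm z ^ n"
      by (intro exI[of _ 1]) (simp add: norm_divide norm_power)
  qed
  then have "((\<lambda>n. z ^ n / of_nat n) has_sum - ln (1 - z)) UNIV"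
    using sums by (rule norm_summable_imp_has_sum)
  \<comment> \<open>The term at \<open>n = 0\<close> is \<open>1 / 0 = 0\<close>, so dropping it
    does not change the sum.\<close>
  then show ?thesis
    by (rule has_sum_cong_neutral[THEN iffD1, rotated -1]) auto
qed

lemma part_sum_phi_ge_1:
  assumes "V zero_seq = 0" and "n \<ge> 1"
  shows "part_sum UNIV (phi V) n \<ge> 1"
proof -
  have fin: "finite (fixpts n (UNIV :: (nat \<Rightarrow> bool) set))"
    using assms(2) by (rule finite_fixpts_bool)
  have "1 = orbit_weight (phi V) n zero_seq"
    by (simp add: orbit_weight_phi shift_funpow_zero_seq assms(1))
  also have "\<dots> \<le> (\<Sum>x\<in>fixpts n UNIV. orbit_weight (phi V) n x)"
    using fin
    by (intro member_le_sum) (simp_all add: fixpts_def orbit_weight_phi shift_funpow_zero_seq)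
  finally show ?thesis
    using fin by (simp add: part_sum_def)
qed

text \<open>The fixed point \<open>zero_seq\<close> keeps every partition sum at least 1, so
  \<open>norm z \<ge> 1\<close> would make the harmonic series converge.\<close>

lemma zeta_abs_conv_phi_norm_less_1:
  assumes "V zero_seq = 0" and "zeta_abs_conv UNIV (phi V) z"
  shows "norm z < 1"
proof (rule ccontr)
  assume z: "\<not> norm z < 1"
  have "(\<lambda>n. 1 / real n) summable_on {1..}"
  proof (rule summable_on_comparison_test)
    show "(\<lambda>n. norm (zeta_term UNIV (phi V) z n)) summable_on {1..}"
      using assms(2) by (simp add: zeta_abs_conv_def)
    show "1 / real n \<le> norm (zeta_term UNIV (phi V) z n)" if "n \<in> {1..}" for n
    proof -
      have "1 * 1 \<le> norm z ^ n * \<bar>part_sum UNIV (phi V) n\<bar>"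
        using z part_sum_phi_ge_1[of V n, OF assms(1)] that by (intro mult_mono) auto
      then show ?thesis
        by (simp add: zeta_term_def norm_mult norm_divide norm_power divide_right_mono)
    qed
  qed simp
  then have "(\<lambda>n. 1 / real n) summable_on UNIV"
    by (rule summable_on_cong_neutral[THEN iffD1, rotated -1]) auto
  then have "summable (\<lambda>n. inverse (of_nat n) :: real)"
    by (simp add: summable_on_UNIV_nonneg_real_iff inverse_eq_divide)
  then show False
    using not_summable_harmonic by blast
qed

lemma zeta2_at_1:
  assumes V0: "V zero_seq = 0" and conv: "zeta_abs_conv UNIV (phi V) z"
  shows "zeta2 V 1 z = (1 - z) * zeta UNIV (phi V) z"
proof -
  have z: "norm z < 1"
    using assms by (rule zeta_abs_conv_phi_norm_less_1)
  \<comment> \<open>The common summand of both double series; the number of ones stands for the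
    \<open>1 / l\<close> of \<open>zeta2_term\<close>.\<close>
  define f :: "nat \<times> (nat \<Rightarrow> bool) \<Rightarrow> complex" where
    "f = (\<lambda>(n, x). z ^ n * of_real (orbit_weight (phi V) n x / real (ones n x)))"
  have fin: "finite (marked n)" if "n \<ge> 1" for n
    using finite_fixpts_bool[OF that] by (simp add: marked_def)
  have weight0: "orbit_weight (phi V) n zero_seq = 1" for n
    by (simp add: orbit_weight_phi shift_funpow_zero_seq V0)
  define q where "q n = part_sum UNIV (phi V) n" for n
  have q: "q n \<ge> 1" if "n \<ge> 1" for n
    using part_sum_phi_ge_1[of V n, OF V0 that] by (simp add: q_def)
  have summable_term: "(\<lambda>n. norm (zeta_term UNIV (phi V) z n)) summable_on {1..}"
    using conv by (simp add: zeta_abs_conv_def)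
  \<comment> \<open>The weights are positive, so the norms over \<open>marked n\<close> sum to
    \<open>norm z ^ n * ((q n - 1) / n)\<close>; as \<open>q n \<ge> 1\<close>, the zeta term
    dominates this.\<close>
  have abs: "(\<lambda>p. norm (f p)) summable_on (SIGMA n:{1..}. marked n)"
    unfolding Infinite_Sum.abs_summable_on_Sigma_iff
  proof (intro conjI ballI)
    show "(\<lambda>x. norm (f (n, x))) summable_on marked n" if "n \<in> {1..}" for n
      using fin that by simp
    show "(\<lambda>n. norm (\<Sum>\<^sub>\<infinity>x\<in>marked n. norm (f (n, x)))) summable_on {1..}"
    proof (rule Infinite_Sum.abs_summable_on_comparison_test[OF summable_term])
      fix n :: nat assume n: "n \<in> {1..}"
      have "(\<Sum>\<^sub>\<infinity>x\<in>marked n. norm (f (n, x))) =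
          norm z ^ n * (\<Sum>x\<in>marked n. orbit_weight (phi V) n x / real (ones n x))"
        using fin n by (simp add: f_def norm_mult norm_power norm_divide orbit_weight_phi sum_distrib_left)
      also have "\<dots> = norm z ^ n * ((q n - 1) / real n)"
        using n by (simp add: sum_marked weight0 q_def)
      finally have eq: "(\<Sum>\<^sub>\<infinity>x\<in>marked n. norm (f (n, x))) = norm z ^ n * ((q n - 1) / real n)" .
      show "norm (\<Sum>\<^sub>\<infinity>x\<in>marked n. norm (f (n, x))) \<le> norm (zeta_term UNIV (phi V) z n)"
        using q[of n] n unfolding eq
        by (simp add: zeta_term_def norm_mult norm_divide norm_power abs_mult
            divide_right_mono mult_left_mono flip: q_def)
    qed
  qed
  then have summ: "f summable_on (SIGMA n:{1..}. marked n)"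
    by (rule abs_summable_summable)
  define B where "B = (SIGMA l:{1..}. fixpts l Sigma_seq)"
  define c :: "nat \<times> (nat \<Rightarrow> nat) \<Rightarrow> nat \<times> (nat \<Rightarrow> bool)"
    where "c = (\<lambda>(l, s). (\<Sum>j<l. s j, kappa s))"
  define h :: "nat \<times> (nat \<Rightarrow> nat) \<Rightarrow> complex"
    where "h = (\<lambda>(l, s). 1 / of_nat l * Xi_term V l z s)"
  have bij: "bij_betw c B (SIGMA n:{1..}. marked n)"
    unfolding c_def B_def by (rule bij_betw_marked)
  \<comment> \<open>Under the coding, \<open>n\<close> is the exponent of \<open>z\<close> in
    \<open>Xi_term\<close> and \<open>ones n x\<close> is \<open>l\<close>.\<close>
  have code: "f (c p) = h p" if "p \<in> B" for p
    using that
    by (auto simp: B_def c_def h_def f_def fixpts_def ones_kappa Xi_term_def orbit_weight_psi)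
  have "(\<lambda>p. f (c p)) summable_on B"
    using summ by (simp only: summable_on_reindex_bij_betw[OF bij])
  then have "h summable_on B"
    by (rule summable_on_cong[THEN iffD1, rotated]) (rule code)
  then have summ': "(\<lambda>(l, s). 1 / of_nat l * Xi_term V l z s) summable_on (SIGMA l:{1..}. fixpts l Sigma_seq)"
    by (simp only: h_def B_def)
  have "(\<Sum>\<^sub>\<infinity>l\<in>{1..}. zeta2_term V 1 z l) =
      (\<Sum>\<^sub>\<infinity>l\<in>{1..}. \<Sum>\<^sub>\<infinity>s\<in>fixpts l Sigma_seq. 1 / of_nat l * Xi_term V l z s)"
    by (simp add: zeta2_term_def Xi_def infsum_cmult_right' del: times_divide_eq_left)
  also have "\<dots> = (\<Sum>\<^sub>\<infinity>(l, s)\<in>(SIGMA l:{1..}. fixpts l Sigma_seq). 1 / of_nat l * Xi_term V l z s)"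
    using summ' by (rule infsum_Sigma'_banach)
  also have "\<dots> = infsum h B"
    by (simp only: h_def B_def)
  also have "\<dots> = (\<Sum>\<^sub>\<infinity>p\<in>B. f (c p))"
    by (rule infsum_cong) (rule code[symmetric])
  also have "\<dots> = infsum f (SIGMA n:{1..}. marked n)"
    using bij by (rule infsum_reindex_bij_betw)
  also have "\<dots> = (\<Sum>\<^sub>\<infinity>n\<in>{1..}. \<Sum>\<^sub>\<infinity>x\<in>marked n. f (n, x))"
    using infsum_Sigma_banach[OF summ] by simp
  \<comment> \<open>The weight 1 of \<open>zero_seq\<close>, missing from the marked sum, becomes
    the subtracted \<open>z ^ n / n\<close>.\<close>
  also have "\<dots> = (\<Sum>\<^sub>\<infinity>n\<in>{1..}. zeta_term UNIV (phi V) z n - z ^ n / of_nat n)"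
  proof (rule infsum_cong)
    fix n :: nat assume n: "n \<in> {1..}"
    have "(\<Sum>\<^sub>\<infinity>x\<in>marked n. f (n, x)) =
        z ^ n * of_real (\<Sum>x\<in>marked n. orbit_weight (phi V) n x / real (ones n x))"
      using fin n by (simp add: f_def sum_distrib_left)
    also have "\<dots> = z ^ n * of_real ((q n - 1) / real n)"
      using n by (simp add: sum_marked weight0 q_def)
    also have "\<dots> = zeta_term UNIV (phi V) z n - z ^ n / of_nat n"
      by (simp add: zeta_term_def diff_divide_distrib algebra_simps flip: q_def)
    finally show "(\<Sum>\<^sub>\<infinity>x\<in>marked n. f (n, x)) = zeta_term UNIV (phi V) z n - z ^ n / of_nat n" .
  qed
  also have "\<dots> = (\<Sum>\<^sub>\<infinity>n\<in>{1..}. zeta_term UNIV (phi V) z n) + ln (1 - z)"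
    using infsumI[OF has_sum_add[OF has_sum_infsum[OF abs_summable_summable[OF summable_term]]
        has_sum_uminusI[OF has_sum_power_div_nat[OF z]]]]
    by simp
  finally have "zeta2 V 1 z = zeta UNIV (phi V) z * exp (ln (1 - z))"
    by (simp only: zeta2_def zeta_def exp_add)
  moreover have "z \<noteq> 1"
    using z by auto
  ultimately show ?thesis
    by simp
qed

text \<open>At \<open>z = 1\<close> the powers in \<open>Xi_term\<close> are 1, which leaves a real
  partition sum read as a complex number; summability carries this embedding through the infinite
  sum.\<close>

lemma zeta2_z_1:
  assumes "zeta_abs_conv Sigma_seq (psi V) w"
  shows "zeta2 V w 1 = zeta Sigma_seq (psi V) w"
proof -
  have "Xi V l 1 = of_real (part_sum Sigma_seq (psi V) l)" if "l \<in> {1..}" for l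
  proof -
    have "(\<lambda>s. norm (orbit_weight (psi V) l s)) summable_on fixpts l Sigma_seq"
      using assms that by (simp add: zeta_abs_conv_def)
    then have "((\<lambda>s. of_real (orbit_weight (psi V) l s) :: complex) has_sum
        of_real (part_sum Sigma_seq (psi V) l)) (fixpts l Sigma_seq)"
      unfolding part_sum_def by (rule has_sum_of_real[OF has_sum_infsum[OF abs_summable_summable]])
    then show ?thesis
      unfolding Xi_def Xi_term_def by (intro infsumI) simp
  qed
  then have "(\<Sum>\<^sub>\<infinity>l\<in>{1..}. zeta2_term V w 1 l) =
      (\<Sum>\<^sub>\<infinity>l\<in>{1..}. zeta_term Sigma_seq (psi V) w l)"
    by (intro infsum_cong) (simp add: zeta2_term_def zeta_term_def)
  then show ?thesis
    by (simp add: zeta2_def zeta_def)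
qed

theorem proposition7:
  fixes V :: "(nat \<Rightarrow> bool) \<Rightarrow> real" and C1 C2 C3 \<theta> :: real
  assumes "continuous_on UNIV V"
    and "C1 > 0"
    and "\<And>x. - C1 \<le> V x \<and> V x \<le> 0"
    and "V zero_seq = 0"
    and "(\<lambda>n. exp (SUP x\<in>cyl n. induced V x)) summable_on {1..}"
    and "(\<Sum>\<^sub>\<infinity>n\<in>{1..}. exp (SUP x\<in>cyl n. induced V x)) < C2"
    and "0 < \<theta>" and "\<theta> < 1" and "C3 > 0"
    and "\<And>n. n \<ge> 1 \<Longrightarrow> induced_var V n \<le> ereal (C3 * \<theta> ^ n)"
    and "(\<lambda>n. 1 / real n * ln (pressure_sum V n)) \<longlonglongrightarrow> 0"
  shows "(\<forall>z. zeta2_abs_conv V 1 z \<and> zeta_abs_conv UNIV (phi V) z \<longrightarrow>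
             zeta2 V 1 z = (1 - z) * zeta UNIV (phi V) z) \<and>
         (\<forall>w. zeta2_abs_conv V w 1 \<and> zeta_abs_conv Sigma_seq (psi V) w \<longrightarrow>
             zeta2 V w 1 = zeta Sigma_seq (psi V) w)"
  by (simp add: zeta2_at_1 zeta2_z_1 assms(4))

end
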